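(* Let $k\ge 2$ be a real number and let $f\in R_k$. Then for every $z\in\mathbb{D}$, writing $r=|z|$, $$\frac{r}{(1-r)^{\frac{2-k}{2}}(1+r)^{\frac{2+k}{2}}}\le |f(z)|\le \frac{r}{(1-r)^{\frac{2+k}{2}}(1+r)^{\frac{2-k}{2}}}$$ and $$\frac{1-kr+r^2}{(1-r)^{2-\frac{k}{2}}(1+r)^{2+\frac{k}{2}}}\le |f'(z)|\le \frac{1+kr+r^2}{(1-r)^{2+\frac{k}{2}}(1+r)^{2-\frac{k}{2}}}.$$
   Context: $\mathbb{D}=\{z\in\mathbb{C}:|z|<1\}$. $\mathcal{A}$ is the family of functions $f$ analytic in $\mathbb{D}$ with Taylor expansion $f(z)=z+a_2z^2+a_3z^3+\cdots$. $\mathcal{P}$ is the family of functions $p(z)=1+c_1z+c_2z^2+\cdots$ analytic in $\mathbb{D}$ such that $p(z)=\frac{1+\phi(z)}{1-\phi(z)}$ for some analytic $\phi:\mathbb{D}\to\mathbb{D}$ with $\phi(0)=0$ (equivalently, $p(0)=1$ and $\operatorname{Re}p(z)>0$ in $\mathbb{D}$). For real $k\ge2$, $R_k$ (functions of bounded radius rotation) is the class of $f\in\mathcal{A}$ for which there exist $p_1,p_2\in\mathcal{P}$ with $$z\frac{f'(z)}{f(z)}=\left(\frac{k}{4}+\frac12\right)p_1(z)-\left(\frac{k}{4}-\frac12\right)p_2(z),\qquad z\in\mathbb{D},$$ where the left-hand side is understood to take the value $1$ at $z=0$. *)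

theory Defs
  imports "HOL-Complex_Analysis.Complex_Analysis"
begin

abbreviation unit_disc :: "complex set" where
  "unit_disc \<equiv> ball 0 1"

text \<open>Functions are total on \<^typ>\<open>complex\<close>; only their values on the open unit disc matter.
  The normalisation $f(z) = z + a_2 z^2 + \cdots$ is expressed by the first two Taylor
  coefficients at the origin.\<close>

definition class_A :: "(complex \<Rightarrow> complex) set" where
  "class_A = {f. f holomorphic_on unit_disc \<and> f 0 = 0 \<and> deriv f 0 = 1}"

definition class_P :: "(complex \<Rightarrow> complex) set" where
  "class_P = {p. p holomorphic_on unit_disc \<and> p 0 = 1 \<and>
     (\<exists>\<phi>. \<phi> holomorphic_on unit_disc \<and> \<phi> ` unit_disc \<subseteq> unit_disc \<and> \<phi> 0 = 0 \<and>
        (\<forall>z\<in>unit_disc. p z = (1 + \<phi> z) / (1 - \<phi> z)))}"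

text \<open>Functions of bounded radius rotation. For the quotient $z f'(z)/f(z)$ to be meaningful
  off the origin, $f$ must not vanish there; since division by zero is total in HOL, this is
  stated explicitly. At the origin the quotient is read as its limit, 1.\<close>

definition class_R :: "real \<Rightarrow> (complex \<Rightarrow> complex) set" where
  "class_R k = {f \<in> class_A.
     (\<forall>z\<in>unit_disc - {0}. f z \<noteq> 0) \<and>
     (\<exists>p\<^sub>1\<in>class_P. \<exists>p\<^sub>2\<in>class_P. \<forall>z\<in>unit_disc.
        (if z = 0 then 1 else z * deriv f z / f z) =
          of_real (k / 4 + 1 / 2) * p\<^sub>1 z - of_real (k / 4 - 1 / 2) * p\<^sub>2 z)}"

end

theory Submission
  imports Defs
begin

text \<open>By the Schwarz lemma every \<open>p\<close> in \<open>class_P\<close> maps the circle of radius \<open>r\<close> into the disc with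
  centre \<open>(1 + r\<^sup>2) / (1 - r\<^sup>2)\<close> and radius \<open>2 * r / (1 - r\<^sup>2)\<close>. The two coefficients in the definition
  of \<open>class_R\<close> differ by 1 and add up to \<open>k / 2\<close>, so \<open>z * deriv f z / f z\<close> lies in the disc with the
  same centre and radius \<open>k * r / (1 - r\<^sup>2)\<close>. Integrating the resulting bounds on its real part along a
  radius bounds \<open>ln (cmod (f z / z))\<close>, and multiplying by the bounds on its modulus bounds
  \<open>cmod (deriv f z)\<close>.\<close>

lemma class_P_disc:
  assumes "p \<in> class_P" "cmod z < 1"
  defines "r \<equiv> cmod z"
  shows "cmod (p z - of_real ((1 + r\<^sup>2) / (1 - r\<^sup>2))) \<le> 2 * r / (1 - r\<^sup>2)"
proof -
  obtain \<phi> where \<phi>: "\<phi> holomorphic_on unit_disc" "\<phi> ` unit_disc \<subseteq> unit_disc" "\<phi> 0 = 0"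
    "\<And>z. z \<in> unit_disc \<Longrightarrow> p z = (1 + \<phi> z) / (1 - \<phi> z)"
    using assms(1) unfolding class_P_def by blast
  have maps: "cmod (\<phi> w) < 1" if "cmod w < 1" for w
    using that \<phi>(2) by (auto simp: image_subset_iff)
  define u where "u = \<phi> z"
  have u1: "cmod u < 1"
    using maps[OF assms(2)] by (simp add: u_def)
  have ur: "cmod u \<le> r"
    unfolding u_def r_def by (rule Schwarz_Lemma(1)[OF \<phi>(1,3) maps assms(2)])
  have r: "0 \<le> r" "r < 1" using assms(2) by (auto simp: r_def)
  have D: "0 < 1 - r\<^sup>2" using r by (simp add: power_less_one_iff abs_square_less_1)
  have nz: "1 - u \<noteq> 0" using u1 by auto
  \<comment> \<open>Subtracting the centre from (1 + u) / (1 - u) leaves 2 / (1 - r^2) times (u -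
    r^2) / (1 - u). So the claim amounts to |u - r^2| <= r |1 - u|. The squares of the two sides
    differ by (1 - r^2) (r^2 - |u|^2), which is nonnegative by the Schwarz bound
    \<open>ur\<close>.\<close>
  have "(cmod (u - of_real (r\<^sup>2)))\<^sup>2 = (cmod u)\<^sup>2 - 2 * r\<^sup>2 * Re u + r\<^sup>2 * r\<^sup>2"
    by (simp add: cmod_power2 del: of_real_power) (simp add: power2_eq_square power4_eq_xxxx algebra_simps)
  moreover have "(r * cmod (1 - u))\<^sup>2 = r\<^sup>2 * (1 - 2 * Re u + (cmod u)\<^sup>2)"
    by (simp add: cmod_power2 power_mult_distrib) (simp add: power2_eq_square algebra_simps)
  ultimately have "(r * cmod (1 - u))\<^sup>2 - (cmod (u - of_real (r\<^sup>2)))\<^sup>2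
      = (1 - r\<^sup>2) * (r\<^sup>2 - (cmod u)\<^sup>2)"
    by (simp only: algebra_simps)
  moreover have "0 \<le> (1 - r\<^sup>2) * (r\<^sup>2 - (cmod u)\<^sup>2)"
    using D ur r by (intro mult_nonneg_nonneg) (auto intro: power_mono)
  ultimately have "(cmod (u - of_real (r\<^sup>2)))\<^sup>2 \<le> (r * cmod (1 - u))\<^sup>2"
    by linarith
  then have key: "cmod (u - of_real (r\<^sup>2)) \<le> r * cmod (1 - u)"
    by (rule power2_le_imp_le) (use r in simp)
  have "p z - of_real ((1 + r\<^sup>2) / (1 - r\<^sup>2)) = of_real (2 / (1 - r\<^sup>2)) * ((u - of_real (r\<^sup>2)) / (1 - u))"
  proof -
    define S where "S = complex_of_real (r\<^sup>2)"
    have "p z = (1 + u) / (1 - u)" unfolding u_def by (rule \<phi>(4)) (use assms(2) in simp)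
    moreover have "1 - S \<noteq> 0"
      using D by (metis S_def less_irrefl of_real_1 of_real_diff of_real_eq_0_iff)
    then have "(1 + u) / (1 - u) - (1 + S) / (1 - S) = 2 / (1 - S) * ((u - S) / (1 - u))"
      using nz by (simp add: diff_frac_eq) (simp add: algebra_simps)
    ultimately show ?thesis
      by (simp only: S_def of_real_divide of_real_add of_real_diff of_real_1 of_real_numeral)
  qed
  then have "cmod (p z - of_real ((1 + r\<^sup>2) / (1 - r\<^sup>2))) = 2 / (1 - r\<^sup>2) * (cmod (u - of_real (r\<^sup>2)) / cmod (1 - u))"
    using D by (simp only: norm_mult norm_divide norm_of_real) simp
  also have "\<dots> \<le> 2 / (1 - r\<^sup>2) * r"
    using key D nz by (intro mult_left_mono) (auto simp: divide_simps)
  finally show ?thesis by simp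
qed

lemma class_R_disc:
  assumes "k \<ge> 2" "f \<in> class_R k" "cmod z < 1" "z \<noteq> 0"
  defines "r \<equiv> cmod z"
  shows "cmod (z * deriv f z / f z - of_real ((1 + r\<^sup>2) / (1 - r\<^sup>2))) \<le> k * r / (1 - r\<^sup>2)"
proof -
  obtain p q where p: "p \<in> class_P" and q: "q \<in> class_P" and
    eq: "\<And>z. z \<in> unit_disc \<Longrightarrow> (if z = 0 then 1 else z * deriv f z / f z) =
          of_real (k / 4 + 1 / 2) * p z - of_real (k / 4 - 1 / 2) * q z"
    using assms(2) unfolding class_R_def by blast
  define C where "C = (1 + r\<^sup>2) / (1 - r\<^sup>2)"
  define R where "R = 2 * r / (1 - r\<^sup>2)"
  define a where "a = k / 4 + 1 / 2"
  define b where "b = k / 4 - 1 / 2"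
  \<comment> \<open>Nonnegativity of \<open>b\<close> is where \<open>k \<ge> 2\<close>
    enters.\<close>
  have ab: "0 \<le> a" "0 \<le> b" "a - b = 1" "a + b = k / 2"
    using assms(1) by (auto simp: a_def b_def)
  have "of_real a - of_real b = (1 :: complex)"
    using ab(3) by (metis of_real_1 of_real_diff)
  \<comment> \<open>As \<open>a - b = 1\<close>, the centre \<open>C\<close> can be shared out as a
    C - b C. The triangle inequality then adds the weights, giving the factor a + b = k / 2.\<close>
  then have split: "of_real a * p z - of_real b * q z - of_real C
      = of_real a * (p z - of_real C) - of_real b * (q z - of_real C)"
    by (simp add: algebra_simps flip: distrib_left)
  have "cmod (of_real a * p z - of_real b * q z - of_real C)
      \<le> a * cmod (p z - of_real C) + b * cmod (q z - of_real C)"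
    unfolding split
    by (rule order_trans[OF norm_triangle_ineq4]) (use ab in \<open>simp add: norm_mult\<close>)
  also have "\<dots> \<le> a * R + b * R"
    using class_P_disc[OF p assms(3)] class_P_disc[OF q assms(3)] ab
    by (intro add_mono mult_left_mono) (auto simp: C_def R_def r_def)
  also have "\<dots> = k / 2 * R" using ab(4) by (metis distrib_right)
  also have "\<dots> = k * r / (1 - r\<^sup>2)" by (simp add: R_def)
  finally show ?thesis
    using eq[of z] assms(3,4) by (simp add: C_def a_def b_def)
qed

text \<open>On the ray from 0 through z, t times the derivative of Re L - G is Re (w L'(w)) - |w|
  G'(|w|) with |w| = t, hence nonpositive. So the difference cannot increase from 0 to |z|.\<close>

lemma Re_le_radial_majorant:
  fixes L :: "complex \<Rightarrow> complex" and G G' :: "real \<Rightarrow> real"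
  assumes L: "L holomorphic_on unit_disc"
    and G: "\<And>t. 0 \<le> t \<Longrightarrow> t < 1 \<Longrightarrow> (G has_real_derivative G' t) (at t)"
    and le: "\<And>w. cmod w < 1 \<Longrightarrow> w \<noteq> 0 \<Longrightarrow> Re (w * deriv L w) \<le> cmod w * G' (cmod w)"
    and z: "cmod z < 1"
  shows "Re (L z) - Re (L 0) \<le> G (cmod z) - G 0"
proof -
  define r where "r = cmod z"
  define \<omega> where "\<omega> = sgn z"
  have r: "0 \<le> r" "r < 1" and zr: "z = of_real r * \<omega>"
    using z by (auto simp: r_def \<omega>_def sgn_div_norm scaleR_conv_of_real field_simps)
  \<comment> \<open>For z = 0 the direction \<open>sgn z\<close> is 0, so the modulus is 1 only for
    nonzero r.\<close>
  have \<omega>: "cmod \<omega> \<le> 1" "r \<noteq> 0 \<Longrightarrow> cmod \<omega> = 1"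
    by (auto simp: \<omega>_def norm_sgn r_def)
  define F where "F = (\<lambda>t. Re (L (of_real t * \<omega>)) - G t)"
  have deriv_F: "(F has_real_derivative (Re (\<omega> * deriv L (of_real t * \<omega>)) - G' t)) (at t)"
    if t: "0 \<le> t" "t < 1" for t
  proof -
    have "cmod (of_real t * \<omega>) < 1"
      using t \<omega>(1) mult_left_le[of "cmod \<omega>" t] by (simp add: norm_mult)
    then have "(L has_field_derivative deriv L (of_real t * \<omega>)) (at (of_real t * \<omega>))"
      by (intro holomorphic_derivI[OF L]) auto
    moreover have "((\<lambda>s. of_real s * \<omega>) has_vector_derivative \<omega>) (at t)"
      by (auto intro!: derivative_eq_intros)
    ultimately have "((\<lambda>s. L (of_real s * \<omega>)) has_vector_derivative (\<omega> * deriv L (of_real t * \<omega>))) (at t)"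
      using field_vector_diff_chain_at[of "\<lambda>s. of_real s * \<omega>"] by (simp add: o_def)
    then have "((\<lambda>s. Re (L (of_real s * \<omega>))) has_real_derivative Re (\<omega> * deriv L (of_real t * \<omega>))) (at t)"
      by (simp add: has_vector_derivative_complex_iff)
    then show ?thesis
      unfolding F_def by (intro DERIV_diff G t)
  qed
  have "F r \<le> F 0"
  \<comment> \<open>The open-interval version avoids t = 0, where \<open>le\<close> says nothing and
    division by t is impossible; continuity suffices at the endpoints.\<close>
  proof (rule DERIV_nonpos_imp_decreasing_open[OF r(1)])
    fix t assume t: "0 < t" "t < r"
    have c: "cmod (of_real t * \<omega>) = t" using \<omega>(2) t by (simp add: norm_mult)
    then have "Re (of_real t * \<omega> * deriv L (of_real t * \<omega>)) \<le> t * G' t"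
      using le[of "of_real t * \<omega>"] t r by fastforce
    also have "Re (of_real t * \<omega> * deriv L (of_real t * \<omega>)) = t * Re (\<omega> * deriv L (of_real t * \<omega>))"
      by (simp add: mult.assoc)
    finally have "Re (\<omega> * deriv L (of_real t * \<omega>)) - G' t \<le> 0"
      using t by simp
    then show "\<exists>y. (F has_real_derivative y) (at t) \<and> y \<le> 0"
      using deriv_F[of t] t r by force
  next
    show "continuous_on {0..r} F"
      using r deriv_F by (force intro!: continuous_at_imp_continuous_on DERIV_isCont)
  qed
  then show ?thesis by (simp add: F_def zr[symmetric]) (simp add: r_def)
qed

text \<open>The primitive of (k + 2 r) / (1 - r^2) that vanishes at 0. It is the logarithm of the
  claimed upper bound for |f(z)| / |z|; replacing k by -k gives the lower bound.\<close>

definition log_distortion :: "real \<Rightarrow> real \<Rightarrow> real" where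
  "log_distortion k r = - ((2 + k) / 2) * ln (1 - r) - ((2 - k) / 2) * ln (1 + r)"

lemma has_derivative_log_distortion:
  assumes "0 \<le> r" "r < 1"
  shows "(log_distortion k has_real_derivative (k + 2 * r) / (1 - r\<^sup>2)) (at r)"
proof -
  have eq: "1 - r\<^sup>2 = (1 - r) * (1 + r)" by (simp add: power2_eq_square algebra_simps)
  have "((\<lambda>r. - ((2 + k) / 2) * ln (1 - r) - ((2 - k) / 2) * ln (1 + r)) has_real_derivative
      - ((2 + k) / 2) * (- 1 / (1 - r)) - ((2 - k) / 2) * (1 / (1 + r))) (at r)"
  proof (intro DERIV_diff DERIV_cmult)
    show "((\<lambda>r. ln (1 - r)) has_real_derivative - 1 / (1 - r)) (at r)"
      using assms by (auto intro!: derivative_eq_intros)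
    show "((\<lambda>r. ln (1 + r)) has_real_derivative 1 / (1 + r)) (at r)"
      using assms by (auto intro!: derivative_eq_intros)
  qed
  moreover have "- ((2 + k) / 2) * (- 1 / (1 - r)) - ((2 - k) / 2) * (1 / (1 + r)) = (k + 2 * r) / (1 - r\<^sup>2)"
    unfolding eq using assms by (simp add: divide_simps) (simp add: algebra_simps)
  ultimately show ?thesis
    by (simp only: log_distortion_def[abs_def])
qed

lemma exp_log_distortion:
  assumes "0 \<le> r" "r < 1"
  shows "exp (log_distortion k r) = 1 / ((1 - r) powr ((2 + k) / 2) * (1 + r) powr ((2 - k) / 2))"
proof -
  have "log_distortion k r = - ((2 + k) / 2 * ln (1 - r) + (2 - k) / 2 * ln (1 + r))"
    by (simp add: log_distortion_def)
  then show ?thesis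
    using assms by (simp only: exp_minus exp_add) (simp add: powr_def inverse_eq_divide)
qed

text \<open>Since f(z) / z has no zeros in the disc, it has a holomorphic logarithm L there, and z
  L' = z f' / f - 1. The disc for z f' / f thus controls the radial derivative of Re L = ln |f(z) /
  z|.\<close>

lemma class_R_growth:
  assumes k: "k \<ge> 2" and f: "f \<in> class_R k" and z: "cmod z < 1"
  shows "cmod z * exp (log_distortion (- k) (cmod z)) \<le> cmod (f z)"
    and "cmod (f z) \<le> cmod z * exp (log_distortion k (cmod z))"
proof -
  have holf: "f holomorphic_on unit_disc" and f0: "f 0 = 0" "deriv f 0 = 1"
    and fnz: "\<And>z. cmod z < 1 \<Longrightarrow> z \<noteq> 0 \<Longrightarrow> f z \<noteq> 0"
    using f by (auto simp: class_R_def class_A_def)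
  \<comment> \<open>The value 1 is f'(0), which removes the singularity at the origin.\<close>
  define h where "h = (\<lambda>z. if z = 0 then 1 else f z / z)"
  have holh: "h holomorphic_on unit_disc"
    by (rule pole_theorem_open_0[OF holf, of 0]) (auto simp: h_def f0)
  have hnz: "h w \<noteq> 0" if "w \<in> unit_disc" for w
    using that fnz[of w] by (simp add: h_def)
  obtain L where L: "L holomorphic_on unit_disc" and "\<And>w. w \<in> unit_disc \<Longrightarrow> exp (L w) = h w"
    using holomorphic_logarithm_exists[OF convex_ball open_ball holh hnz, of 0] by auto
  then have expL: "exp (L w) = h w" if "cmod w < 1" for w using that by simp
  have fexp: "f w = w * exp (L w)" if "cmod w < 1" for w
    using expL[OF that] f0 by (auto simp: h_def)
  have L': "w * deriv L w = w * deriv f w / f w - 1" if w: "cmod w < 1" "w \<noteq> 0" for w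
  proof -
    have "(L has_field_derivative deriv L w) (at w)"
      using w by (intro holomorphic_derivI[OF L]) auto
    then have "((\<lambda>w. w * exp (L w)) has_field_derivative exp (L w) * (1 + w * deriv L w)) (at w)"
      by (auto intro!: derivative_eq_intros simp: algebra_simps)
    then have "(f has_field_derivative exp (L w) * (1 + w * deriv L w)) (at w)"
      by (rule has_field_derivative_transform_within_open[where S = unit_disc]) (use w fexp in auto)
    then have "deriv f w = exp (L w) * (1 + w * deriv L w)" by (rule DERIV_imp_deriv)
    then show ?thesis using fexp[OF w(1)] w(2) by simp
  qed
  \<comment> \<open>Subtracting 1 moves the centre to 2 r^2 / (1 - r^2), so the extreme real parts
    are r times the derivatives of \<open>log_distortion (- k)\<close> and
    \<open>log_distortion k\<close>.\<close>
  have Re_bounds: "cmod w * ((- k + 2 * cmod w) / (1 - (cmod w)\<^sup>2)) \<le> Re (w * deriv L w)"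
      "Re (w * deriv L w) \<le> cmod w * ((k + 2 * cmod w) / (1 - (cmod w)\<^sup>2))"
    if w: "cmod w < 1" "w \<noteq> 0" for w
  proof -
    define r where "r = cmod w"
    have D: "1 - r\<^sup>2 > 0" using w by (simp add: r_def abs_square_less_1)
    have "\<bar>Re (w * deriv f w / f w) - (1 + r\<^sup>2) / (1 - r\<^sup>2)\<bar> \<le> k * r / (1 - r\<^sup>2)"
      using order_trans[OF abs_Re_le_cmod class_R_disc[OF k f w]] by (simp add: r_def)
    then have "\<bar>Re (w * deriv L w) - ((1 + r\<^sup>2) / (1 - r\<^sup>2) - 1)\<bar> \<le> k * r / (1 - r\<^sup>2)"
      by (simp add: L'[OF w])
    moreover have "(1 + r\<^sup>2) / (1 - r\<^sup>2) - 1 = 2 * r\<^sup>2 / (1 - r\<^sup>2)"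
      using D by (simp add: divide_simps)
    moreover have split: "r * ((s + 2 * r) / (1 - r\<^sup>2)) = 2 * r\<^sup>2 / (1 - r\<^sup>2) + s * r / (1 - r\<^sup>2)" for s
      by (simp add: add_divide_distrib[symmetric] power2_eq_square algebra_simps)
    ultimately show "cmod w * ((- k + 2 * cmod w) / (1 - (cmod w)\<^sup>2)) \<le> Re (w * deriv L w)"
      "Re (w * deriv L w) \<le> cmod w * ((k + 2 * cmod w) / (1 - (cmod w)\<^sup>2))"
      unfolding r_def[symmetric] split by (simp_all only: abs_le_iff mult_minus_left minus_divide_left[symmetric]) linarith+
  qed
  \<comment> \<open>The choice of branch leaves \<open>L 0\<close> free up to multiples of 2 pi i,
    but its real part is determined.\<close>
  have L0: "Re (L 0) = 0"
    using expL[of 0] by (metis h_def exp_eq_1 norm_zero zero_less_one)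
  have "Re (L z) - Re (L 0) \<le> log_distortion k (cmod z) - log_distortion k 0"
    using Re_bounds(2) by (intro Re_le_radial_majorant[OF L has_derivative_log_distortion _ z])
  then have up: "Re (L z) \<le> log_distortion k (cmod z)"
    by (simp add: L0 log_distortion_def)
  \<comment> \<open>The lower bound is the same majorant argument applied to -L.\<close>
  have "Re (- L z) - Re (- L 0) \<le> - log_distortion (- k) (cmod z) - - log_distortion (- k) 0"
  proof (rule Re_le_radial_majorant[OF _ _ _ z])
    show "(\<lambda>w. - L w) holomorphic_on unit_disc" by (intro holomorphic_intros L)
    show "((\<lambda>t. - log_distortion (- k) t) has_real_derivative - ((- k + 2 * t) / (1 - t\<^sup>2))) (at t)"
      if "0 \<le> t" "t < 1" for t
      by (intro DERIV_minus has_derivative_log_distortion that)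
    show "Re (w * deriv (\<lambda>w. - L w) w) \<le> cmod w * - ((- k + 2 * cmod w) / (1 - (cmod w)\<^sup>2))"
      if w: "cmod w < 1" "w \<noteq> 0" for w
    proof -
      have "(L has_field_derivative deriv L w) (at w)"
        using w by (intro holomorphic_derivI[OF L]) auto
      then have "deriv (\<lambda>w. - L w) w = - deriv L w"
        by (intro DERIV_imp_deriv DERIV_minus)
      then show ?thesis using Re_bounds(1)[OF w]
        by (simp only: mult_minus_right uminus_complex.sel neg_le_iff_le)
    qed
  qed
  then have lo: "log_distortion (- k) (cmod z) \<le> Re (L z)"
    by (simp add: L0 log_distortion_def)
  show "cmod z * exp (log_distortion (- k) (cmod z)) \<le> cmod (f z)"
    and "cmod (f z) \<le> cmod z * exp (log_distortion k (cmod z))"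
    using up lo by (auto simp: fexp[OF z] norm_mult intro!: mult_left_mono)
qed

theorem theorem2p2:
  fixes k :: real and f :: "complex \<Rightarrow> complex"
  assumes "k \<ge> 2" and "f \<in> class_R k"
  shows "\<forall>z\<in>unit_disc. \<forall>r. r = cmod z \<longrightarrow>
    r / ((1 - r) powr ((2 - k) / 2) * (1 + r) powr ((2 + k) / 2)) \<le> cmod (f z) \<and>
    cmod (f z) \<le> r / ((1 - r) powr ((2 + k) / 2) * (1 + r) powr ((2 - k) / 2)) \<and>
    (1 - k * r + r\<^sup>2) / ((1 - r) powr (2 - k / 2) * (1 + r) powr (2 + k / 2))
      \<le> cmod (deriv f z) \<and>
    cmod (deriv f z)
      \<le> (1 + k * r + r\<^sup>2) / ((1 - r) powr (2 + k / 2) * (1 + r) powr (2 - k / 2))"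
proof (intro ballI allI impI)
  fix z :: complex and r :: real
  assume "z \<in> unit_disc" and r: "r = cmod z"
  then have z: "cmod z < 1" and r0: "0 \<le> r" "r < 1" by auto
  note growth = class_R_growth[OF assms z, folded r]
  have D: "1 - r\<^sup>2 > 0" using r0 by (simp add: abs_square_less_1)
  \<comment> \<open>Splitting off 1 - r^2 from the powers shows the derivative bound as a bound for
    |z f' / f| times one for |f(z) / z|. The cases s = k and s = -k give the upper and the lower
    bound.\<close>
  have quot: "(1 + s * r + r\<^sup>2) / ((1 - r) powr (2 + s / 2) * (1 + r) powr (2 - s / 2))
      = (1 + s * r + r\<^sup>2) / (1 - r\<^sup>2) * exp (log_distortion s r)" for s
  proof -
    have "(1 - r) powr (2 + s / 2) = (1 - r) * (1 - r) powr ((2 + s) / 2)"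
      using r0 powr_add[of "1 - r" 1 "(2 + s) / 2"] by (simp add: add_divide_distrib)
    moreover have "(1 + r) powr (2 - s / 2) = (1 + r) * (1 + r) powr ((2 - s) / 2)"
      using r0 powr_add[of "1 + r" 1 "(2 - s) / 2"] by (simp add: diff_divide_distrib)
    moreover have "1 - r\<^sup>2 = (1 - r) * (1 + r)" by (simp add: power2_eq_square algebra_simps)
    ultimately show ?thesis using r0 by (simp add: exp_log_distortion)
  qed
  have quot_minus: "(1 - k * r + r\<^sup>2) / ((1 - r) powr (2 - k / 2) * (1 + r) powr (2 + k / 2))
      = (1 - k * r + r\<^sup>2) / (1 - r\<^sup>2) * exp (log_distortion (- k) r)"
    using quot[of "- k"]
    by (simp only: mult_minus_left minus_divide_left[symmetric] add_uminus_conv_diff diff_minus_eq_add)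
  have derivs: "(1 - k * r + r\<^sup>2) / (1 - r\<^sup>2) * exp (log_distortion (- k) r) \<le> cmod (deriv f z) \<and>
      cmod (deriv f z) \<le> (1 + k * r + r\<^sup>2) / (1 - r\<^sup>2) * exp (log_distortion k r)"
  proof (cases "z = 0")
    \<comment> \<open>At the origin both bounds equal 1, the value of f'(0).\<close>
    case True
    then show ?thesis using assms(2) r by (simp add: class_R_def class_A_def log_distortion_def)
  next
    case False
    define W where "W = z * deriv f z / f z"
    have "f z \<noteq> 0" using assms(2) z False by (auto simp: class_R_def)
    then have "r * cmod (deriv f z) = cmod W * cmod (f z)"
      by (simp add: W_def norm_mult norm_divide r)
    moreover have "r > 0" using False r by simp
    ultimately have dW: "cmod (deriv f z) = cmod W * (cmod (f z) / r)" by (simp add: field_simps)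
    have disc: "cmod (W - of_real ((1 + r\<^sup>2) / (1 - r\<^sup>2))) \<le> k * r / (1 - r\<^sup>2)"
      using class_R_disc[OF assms z False] by (simp add: W_def r)
    have nC: "cmod (of_real ((1 + r\<^sup>2) / (1 - r\<^sup>2))) = (1 + r\<^sup>2) / (1 - r\<^sup>2)"
      using D by (simp only: norm_of_real) simp
    have W: "(1 - k * r + r\<^sup>2) / (1 - r\<^sup>2) \<le> cmod W" "cmod W \<le> (1 + k * r + r\<^sup>2) / (1 - r\<^sup>2)"
      using disc norm_triangle_ineq2[of W "of_real ((1 + r\<^sup>2) / (1 - r\<^sup>2))"]
        norm_triangle_ineq3[of W "of_real ((1 + r\<^sup>2) / (1 - r\<^sup>2))"]
      unfolding nC by (simp_all add: add_divide_distrib diff_divide_distrib)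
    have q: "exp (log_distortion (- k) r) \<le> cmod (f z) / r" "cmod (f z) / r \<le> exp (log_distortion k r)"
      using growth \<open>r > 0\<close> by (simp_all add: field_simps)
    \<comment> \<open>For k > 2 the factor 1 - k r + r^2 is negative when r is near 1, so the two
      lower bounds are not multiplied directly: first \<open>W(1)\<close> is scaled by a positive
      exponential, then \<open>q(1)\<close> by |W|.\<close>
    have "(1 - k * r + r\<^sup>2) / (1 - r\<^sup>2) * exp (log_distortion (- k) r) \<le> cmod W * exp (log_distortion (- k) r)"
      using W(1) by (intro mult_right_mono) auto
    also have "\<dots> \<le> cmod W * (cmod (f z) / r)"
      using q(1) by (intro mult_left_mono) auto
    finally have "(1 - k * r + r\<^sup>2) / (1 - r\<^sup>2) * exp (log_distortion (- k) r) \<le> cmod (deriv f z)"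
      by (simp only: dW)
    moreover have "cmod (deriv f z) \<le> (1 + k * r + r\<^sup>2) / (1 - r\<^sup>2) * exp (log_distortion k r)"
      unfolding dW using W(2) q(2) r0 by (intro mult_mono order_trans[OF norm_ge_zero W(2)]) auto
    ultimately show ?thesis ..
  qed
  show "r / ((1 - r) powr ((2 - k) / 2) * (1 + r) powr ((2 + k) / 2)) \<le> cmod (f z) \<and>
    cmod (f z) \<le> r / ((1 - r) powr ((2 + k) / 2) * (1 + r) powr ((2 - k) / 2)) \<and>
    (1 - k * r + r\<^sup>2) / ((1 - r) powr (2 - k / 2) * (1 + r) powr (2 + k / 2))
      \<le> cmod (deriv f z) \<and>
    cmod (deriv f z)
      \<le> (1 + k * r + r\<^sup>2) / ((1 - r) powr (2 + k / 2) * (1 + r) powr (2 - k / 2))"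
    using growth derivs unfolding quot[of k] quot_minus
    by (simp add: exp_log_distortion[OF r0])
qed

end
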